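(* Let $0<\alpha\le 1/2$. Quiet dust solutions ($K=0$) on the spacetime $\big([1,\infty)\times\mathbb T^3,\,-dt^2+t^{2\alpha}\delta_{ij}dx^idx^j\big)$ are unstable: there exists a sequence of smooth initial data $(\rho_n,u_n^\mu)$ at $t=1$ for the relativistic Euler equations with $p=0$, converging smoothly as $n\to\infty$ to the initial data $(\rho,u^\mu)=(\rho_c,(\partial_t)^\mu)$, $\rho_c>0$ constant, of a quiet fluid solution, such that for every $n$ the solution launched by $(\rho_n,u^\mu_n)$ forms a singularity in finite time.
   Context: Here $\mathbb T^3=(\mathbb R/2\pi\mathbb Z)^3$ with coordinates $x^1,x^2,x^3$. The relativistic Euler equations for energy density $\rho>0$, pressure $p$ and velocity $u^\mu$ with $u_\mu u^\mu=-1$ (future directed) are $$u^\mu\nabla_\mu\rho+(\rho+p)\nabla_\mu u^\mu=0,\qquad (\rho+p)u^\mu\nabla_\mu u^\nu+(g^{\mu\nu}+u^\mu u^\nu)\partial_\mu p=0,$$ where $g$ is the given (fixed) spacetime metric; the equation of state is $p=K\rho$, so dust means $K=0$, $p=0$. The fluids are taken $\mathbb T^2$-symmetric: $\rho=\rho(t,x)$, $u^\mu=(u^0(t,x),u^1(t,x),0,0)$ with $x=x^1$, $2\pi$-periodic in $x$. In this case $u:=u^1$ decouples and satisfies $\partial_t u+\big(t^{2\alpha}u^2+1\big)^{-1/2}u\,\partial_x u=-2\alpha t^{-1}u$. A quiet fluid solution is a spatially homogeneous solution with $u^\mu=(\partial_t)^\mu$. "Forms a singularity in finite time" means that the classical ($C^1$)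 solution with the given data at $t=1$ does not exist on all of $[1,\infty)\times\mathbb T^3$. *)

theory Defs
  imports "HOL-Analysis.Analysis"
begin

(* Spacetime events and tangent vectors are elements of real^4 with component 0 the time
   component and components 1, 2, 3 the spatial ones; points of a time slice are elements of
   real^3 (components 1, 2, 3).  Functions on the torus (R / 2 pi Z)^3 are functions on real^3
   that are 2 pi - periodic in every coordinate. *)

definition spacetime :: "(real^4) set" where
  "spacetime = {x. 1 \<le> x $ 0}"

definition event :: "real \<Rightarrow> real^3 \<Rightarrow> real^4" where
  "event t y = (\<chi> \<mu>. if \<mu> = 0 then t else if \<mu> = 1 then y $ 1 else if \<mu> = 2 then y $ 2 else y $ 3)"

definition torus_periodic :: "(real^3 \<Rightarrow> 'b) \<Rightarrow> bool" where
  "torus_periodic f \<longleftrightarrow> (\<forall>y i. f (y + axis i (2 * pi)) = f y)"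

definition space_periodic :: "(real^4 \<Rightarrow> 'b) \<Rightarrow> bool" where
  "space_periodic f \<longleftrightarrow> (\<forall>x\<in>spacetime. \<forall>i. i \<noteq> 0 \<longrightarrow> f (x + axis i (2 * pi)) = f x)"

(* Derivatives are taken within the domain S, hence one-sided in t on the initial slice t = 1. *)

definition pd :: "(real^'n) set \<Rightarrow> 'n::finite \<Rightarrow> (real^'n \<Rightarrow> 'b::real_normed_vector) \<Rightarrow> real^'n \<Rightarrow> 'b" where
  "pd S i f x = frechet_derivative f (at x within S) (axis i 1)"

definition C1_on :: "(real^'n::finite) set \<Rightarrow> (real^'n \<Rightarrow> 'b::real_normed_vector) \<Rightarrow> bool" where
  "C1_on S f \<longleftrightarrow> f differentiable_on S \<and> (\<forall>i. continuous_on S (pd S i f))"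

primrec iter_pd :: "'n::finite list \<Rightarrow> (real^'n \<Rightarrow> 'b::real_normed_vector) \<Rightarrow> real^'n \<Rightarrow> 'b" where
  "iter_pd [] f = f"
| "iter_pd (i # ks) f = pd UNIV i (iter_pd ks f)"

definition smooth :: "(real^'n::finite \<Rightarrow> 'b::real_normed_vector) \<Rightarrow> bool" where
  "smooth f \<longleftrightarrow> (\<forall>ks. iter_pd ks f differentiable_on UNIV)"

definition converges_smoothly ::
  "(nat \<Rightarrow> real^'n::finite \<Rightarrow> 'b::real_normed_vector) \<Rightarrow> (real^'n \<Rightarrow> 'b) \<Rightarrow> bool" where
  "converges_smoothly f f\<^sub>0 \<longleftrightarrow>
     (\<forall>ks. uniform_limit UNIV (\<lambda>n. iter_pd ks (f n)) (iter_pd ks f\<^sub>0) sequentially)"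

type_synonym metric = "real^4 \<Rightarrow> real^4^4"

definition power_law_metric :: "real \<Rightarrow> metric" where
  "power_law_metric \<alpha> x =
     (\<chi> \<mu> \<nu>. if \<mu> \<noteq> \<nu> then 0 else if \<mu> = 0 then -1 else (x $ 0) powr (2 * \<alpha>))"

definition christoffel :: "metric \<Rightarrow> 4 \<Rightarrow> 4 \<Rightarrow> 4 \<Rightarrow> real^4 \<Rightarrow> real" where
  "christoffel g l \<mu> \<nu> x =
     (1/2) * (\<Sum>\<sigma>\<in>UNIV. matrix_inv (g x) $ l $ \<sigma> *
       (pd spacetime \<mu> (\<lambda>y. g y $ \<sigma> $ \<nu>) x
        + pd spacetime \<nu> (\<lambda>y. g y $ \<sigma> $ \<mu>) x
        - pd spacetime \<sigma> (\<lambda>y. g y $ \<mu> $ \<nu>) x))"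

(* The component nabla_mu u^nu. *)
definition cov_deriv :: "metric \<Rightarrow> (real^4 \<Rightarrow> real^4) \<Rightarrow> 4 \<Rightarrow> 4 \<Rightarrow> real^4 \<Rightarrow> real" where
  "cov_deriv g u \<mu> \<nu> x =
     pd spacetime \<mu> (\<lambda>y. u y $ \<nu>) x + (\<Sum>l\<in>UNIV. christoffel g \<nu> \<mu> l x * u x $ l)"

definition euler_equations ::
  "metric \<Rightarrow> (real^4 \<Rightarrow> real) \<Rightarrow> (real^4 \<Rightarrow> real) \<Rightarrow> (real^4 \<Rightarrow> real^4) \<Rightarrow> real^4 \<Rightarrow> bool" where
  "euler_equations g p \<rho> u x \<longleftrightarrow>
     (\<Sum>\<mu>\<in>UNIV. u x $ \<mu> * pd spacetime \<mu> \<rho> x)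
       + (\<rho> x + p x) * (\<Sum>\<mu>\<in>UNIV. cov_deriv g u \<mu> \<mu> x) = 0 \<and>
     (\<forall>\<nu>. (\<rho> x + p x) * (\<Sum>\<mu>\<in>UNIV. u x $ \<mu> * cov_deriv g u \<mu> \<nu> x)
       + (\<Sum>\<mu>\<in>UNIV. (matrix_inv (g x) $ \<mu> $ \<nu> + u x $ \<mu> * u x $ \<nu>) * pd spacetime \<mu> p x) = 0)"

definition future_unit :: "metric \<Rightarrow> real^4 \<Rightarrow> real^4 \<Rightarrow> bool" where
  "future_unit g x v \<longleftrightarrow> (\<Sum>\<mu>\<in>UNIV. \<Sum>\<nu>\<in>UNIV. g x $ \<mu> $ \<nu> * v $ \<mu> * v $ \<nu>) = -1 \<and> v $ 0 > 0"

(* Global classical solution on [1, infinity) x T^3 with equation of state p = K rho. *)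
definition fluid_solution :: "metric \<Rightarrow> real \<Rightarrow> (real^4 \<Rightarrow> real) \<Rightarrow> (real^4 \<Rightarrow> real^4) \<Rightarrow> bool" where
  "fluid_solution g K \<rho> u \<longleftrightarrow>
     C1_on spacetime \<rho> \<and> C1_on spacetime u \<and>
     space_periodic \<rho> \<and> space_periodic u \<and>
     (\<forall>x\<in>spacetime. \<rho> x > 0 \<and> future_unit g x (u x) \<and> euler_equations g (\<lambda>y. K * \<rho> y) \<rho> u x)"

definition quiet_fluid_solution :: "metric \<Rightarrow> real \<Rightarrow> (real^4 \<Rightarrow> real) \<Rightarrow> (real^4 \<Rightarrow> real^4) \<Rightarrow> bool" where
  "quiet_fluid_solution g K \<rho> u \<longleftrightarrow>
     fluid_solution g K \<rho> u \<and>
     (\<forall>x\<in>spacetime. \<forall>y\<in>spacetime. x $ 0 = y $ 0 \<longrightarrow> \<rho> x = \<rho> y) \<and>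
     (\<forall>x\<in>spacetime. u x = axis 0 1)"

definition smooth_initial_data :: "metric \<Rightarrow> (real^3 \<Rightarrow> real) \<Rightarrow> (real^3 \<Rightarrow> real^4) \<Rightarrow> bool" where
  "smooth_initial_data g \<rho>\<^sub>0 u\<^sub>0 \<longleftrightarrow>
     smooth \<rho>\<^sub>0 \<and> smooth u\<^sub>0 \<and> torus_periodic \<rho>\<^sub>0 \<and> torus_periodic u\<^sub>0 \<and>
     (\<forall>y. \<rho>\<^sub>0 y > 0 \<and> future_unit g (event 1 y) (u\<^sub>0 y))"

definition T2_symmetric_data :: "(real^3 \<Rightarrow> real) \<Rightarrow> (real^3 \<Rightarrow> real^4) \<Rightarrow> bool" where
  "T2_symmetric_data \<rho>\<^sub>0 u\<^sub>0 \<longleftrightarrow>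
     (\<forall>y z. y $ 1 = z $ 1 \<longrightarrow> \<rho>\<^sub>0 y = \<rho>\<^sub>0 z \<and> u\<^sub>0 y = u\<^sub>0 z) \<and>
     (\<forall>y. u\<^sub>0 y $ 2 = 0 \<and> u\<^sub>0 y $ 3 = 0)"

definition has_initial_data ::
  "(real^4 \<Rightarrow> real) \<Rightarrow> (real^4 \<Rightarrow> real^4) \<Rightarrow> (real^3 \<Rightarrow> real) \<Rightarrow> (real^3 \<Rightarrow> real^4) \<Rightarrow> bool" where
  "has_initial_data \<rho> u \<rho>\<^sub>0 u\<^sub>0 \<longleftrightarrow> (\<forall>y. \<rho> (event 1 y) = \<rho>\<^sub>0 y \<and> u (event 1 y) = u\<^sub>0 y)"

(* Solutions are not required to share the symmetry of the data: no global C^1 solution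
   whatsoever attains them. *)
definition forms_singularity :: "metric \<Rightarrow> real \<Rightarrow> (real^3 \<Rightarrow> real) \<Rightarrow> (real^3 \<Rightarrow> real^4) \<Rightarrow> bool" where
  "forms_singularity g K \<rho>\<^sub>0 u\<^sub>0 \<longleftrightarrow>
     \<not> (\<exists>\<rho> u. fluid_solution g K \<rho> u \<and> has_initial_data \<rho> u \<rho>\<^sub>0 u\<^sub>0)"

end

(* For dust, the momentum equation says that the fluid elements move on geodesics, and along these
   the comoving momentum P^i = t^(2 alpha) u^i is constant.  A fluid element with initial momentum
   (p, 0, 0) therefore travels with the explicit coordinate velocity
   v(t) = p t^(-2 alpha) / sqrt (1 + p^2 t^(-2 alpha)), and this is not integrable on [1, infinity)
   exactly because alpha <= 1/2.  With the data u = (cosh w, sinh w, 0, 0), w = - e sin(x^1), the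
   element starting at x^1 = pi/2 consequently reaches, in finite time, the element at rest at
   x^1 = 0; there the velocity would have two different values. *)

theory Submission
  imports Defs
begin

text \<open>A solution need not share the symmetry of its data, so the decoupled scalar equation for
  u^1 is not at hand: u^2 and u^3 vanish on the initial slice, but that they still vanish later on
  the curve has to be proved. The three comoving momenta are therefore estimated together. In the
  singularity argument the density enters only through its positivity, by which it cancels from the
  momentum equation; perturbing the velocity and keeping the density constant is thus enough. At t =
  1 the scale factor is 1, so the hyperbolic form of the data is normalized by cosh^2 - sinh^2 = 1
  and involves no square root; its derivatives of every order are polynomials in a few functions
  that converge uniformly as e tends to 0. Since t^(-2 alpha) >= 1/t, the distance covered by the
  moving element grows at least like a multiple of log t, which gives an explicit upper bound for
  the collision time.\<close>

section \<open>Partial derivatives on the half-space t >= 1\<close>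

lemma axis_eq_if: "axis i x $ j = (if j = i then x else 0)"
  by (simp add: axis_def)

text \<open>Even on the slice t = 1, small positive multiples of every basis vector stay in the
  half-space. This makes the derivative within \<open>spacetime\<close> unique, so \<open>pd\<close>
  can be read off from any derivative.\<close>

lemma pd_spacetime_eq:
  assumes "x \<in> spacetime" "(f has_derivative D) (at x within spacetime)"
  shows "pd spacetime i f x = D (axis i 1)"
proof -
  have f': "(f has_derivative frechet_derivative f (at x within spacetime)) (at x within spacetime)"
    using assms(2) frechet_derivative_works differentiableI by blast
  have "frechet_derivative f (at x within spacetime) = D"
  proof (rule frechet_derivative_unique_within[OF f' assms(2)])
    fix b :: "real^4" and e :: real
    assume b: "b \<in> Basis" and "0 < e"
    obtain k where "b = axis k 1" using b by (auto simp: Basis_vec_def)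
    then have "x + (e/2) *\<^sub>R b \<in> spacetime"
      using assms(1) \<open>0 < e\<close> by (auto simp: spacetime_def axis_eq_if)
    then show "\<exists>d. 0 < \<bar>d\<bar> \<and> \<bar>d\<bar> < e \<and> x + d *\<^sub>R b \<in> spacetime"
      using \<open>0 < e\<close> by (intro exI[of _ "e/2"]) auto
  qed
  then show ?thesis by (simp add: pd_def)
qed

lemma has_derivative_pd_spacetime:
  assumes "(f :: real^4 \<Rightarrow> real) differentiable (at x within spacetime)"
  shows "(f has_derivative (\<lambda>h. \<Sum>i\<in>UNIV. h $ i * pd spacetime i f x)) (at x within spacetime)"
proof -
  let ?D = "frechet_derivative f (at x within spacetime)"
  have D: "(f has_derivative ?D) (at x within spacetime)"
    using assms frechet_derivative_works by blast
  interpret bounded_linear ?D using D by (rule has_derivative_bounded_linear)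
  have "?D h = (\<Sum>i\<in>UNIV. h $ i * pd spacetime i f x)" for h
  proof -
    have "?D h = ?D (\<Sum>i\<in>UNIV. (h $ i) *s axis i 1)" by (simp add: basis_expansion)
    also have "\<dots> = (\<Sum>i\<in>UNIV. ?D ((h $ i) *\<^sub>R axis i 1))"
      by (simp add: sum scalar_mult_eq_scaleR)
    also have "\<dots> = (\<Sum>i\<in>UNIV. h $ i * pd spacetime i f x)"
      by (simp add: scaleR pd_def)
    finally show ?thesis .
  qed
  then have "?D = (\<lambda>h. \<Sum>i\<in>UNIV. h $ i * pd spacetime i f x)" by (rule ext)
  with D show ?thesis by simp
qed

lemma pd_spacetime_component:
  fixes u :: "real^4 \<Rightarrow> real^4"
  assumes "x \<in> spacetime" "u differentiable (at x within spacetime)"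
  shows "pd spacetime i (\<lambda>y. u y $ k) x = pd spacetime i u x $ k"
proof -
  have D: "(u has_derivative frechet_derivative u (at x within spacetime)) (at x within spacetime)"
    using assms(2) frechet_derivative_works by blast
  have "((\<lambda>y. u y $ k) has_derivative (\<lambda>h. frechet_derivative u (at x within spacetime) h $ k))
      (at x within spacetime)"
    by (rule bounded_linear.has_derivative[OF bounded_linear_vec_nth D])
  from pd_spacetime_eq[OF assms(1) this] show ?thesis by (simp add: pd_def)
qed

lemma pd_time_function:
  assumes "x \<in> spacetime" "(f has_real_derivative d) (at (x $ 0))"
  shows "pd spacetime i (\<lambda>y. f (y $ 0)) x = (if i = 0 then d else 0)"
proof -
  have "(f has_derivative (*) d) (at (x $ 0))"
    using assms(2) by (simp add: has_field_derivative_def)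
  then have "((\<lambda>y. f (y $ 0)) has_derivative (\<lambda>h. d * (h $ 0))) (at x within spacetime)"
    by (intro has_derivative_compose[OF bounded_linear_imp_has_derivative[OF bounded_linear_vec_nth]])
  from pd_spacetime_eq[OF assms(1) this] show ?thesis by (auto simp: axis_eq_if)
qed

lemma pd_spacetime_const:
  assumes "x \<in> spacetime"
  shows "pd spacetime i (\<lambda>_. c) x = 0"
  using pd_spacetime_eq[OF assms has_derivative_const[of c]] .

section \<open>Inverse and Christoffel symbols of the power-law metric\<close>

lemma matrix_inv_unique:
  fixes A :: "'a::field^'n^'n"
  assumes "A ** B = mat 1" "B ** A = mat 1"
  shows "matrix_inv A = B"
proof -
  have "A ** matrix_inv A = mat 1 \<and> matrix_inv A ** A = mat 1"
    unfolding matrix_inv_def using assms by (rule_tac someI[of _ B]) blast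
  then have "B = B ** (A ** matrix_inv A)" "B ** A ** matrix_inv A = matrix_inv A"
    using assms by simp_all
  then show ?thesis by (simp add: matrix_mul_assoc)
qed

lemma matrix_inv_diagonal:
  fixes d :: "'n::finite \<Rightarrow> 'a::field"
  assumes "\<And>i. d i \<noteq> 0"
  shows "matrix_inv (\<chi> i j. if i \<noteq> j then 0 else d i) = (\<chi> i j. if i \<noteq> j then 0 else inverse (d i))"
    (is "matrix_inv ?A = ?B")
proof (rule matrix_inv_unique)
  have *: "(\<Sum>k\<in>UNIV. (if i \<noteq> k then 0 else a i) * (if k \<noteq> j then 0 else b k)) = (if i = j then a i * b i else 0)"
    for a b :: "'n \<Rightarrow> 'a" and i j
  proof -
    have "(\<Sum>k\<in>UNIV. (if i \<noteq> k then 0 else a i) * (if k \<noteq> j then 0 else b k)) =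
       (\<Sum>k\<in>UNIV. if i = k then (if i = j then a i * b i else 0) else 0)"
      by (rule sum.cong) auto
    then show ?thesis by simp
  qed
  show "?A ** ?B = mat 1" "?B ** ?A = mat 1"
    using assms by (auto simp: matrix_matrix_mult_def mat_def vec_eq_iff
      *[of _ d _ "\<lambda>k. inverse (d k)"] *[of _ "\<lambda>k. inverse (d k)" _ d])
qed

lemma power_law_metric_inv:
  assumes "x \<in> spacetime"
  shows "matrix_inv (power_law_metric \<alpha> x) =
    (\<chi> \<mu> \<nu>. if \<mu> \<noteq> \<nu> then 0 else if \<mu> = 0 then -1 else (x $ 0) powr (- (2 * \<alpha>)))"
proof -
  define d where "d \<mu> = (if \<mu> = 0 then -1 else (x $ 0) powr (2 * \<alpha>))" for \<mu> :: 4
  have "x $ 0 > 0" using assms by (simp add: spacetime_def)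
  then have d: "d \<mu> \<noteq> 0" for \<mu> by (simp add: d_def)
  have "power_law_metric \<alpha> x = (\<chi> \<mu> \<nu>. if \<mu> \<noteq> \<nu> then 0 else d \<mu>)"
    by (auto simp: power_law_metric_def d_def vec_eq_iff)
  then have "matrix_inv (power_law_metric \<alpha> x) = (\<chi> \<mu> \<nu>. if \<mu> \<noteq> \<nu> then 0 else inverse (d \<mu>))"
    using matrix_inv_diagonal[of d, OF d] by simp
  then show ?thesis by (auto simp: d_def vec_eq_iff powr_minus)
qed

lemma pd_power_law_metric:
  assumes "x \<in> spacetime"
  shows "pd spacetime k (\<lambda>y. power_law_metric \<alpha> y $ i $ j) x =
    (if k = 0 \<and> i = j \<and> i \<noteq> 0 then 2 * \<alpha> * (x $ 0) powr (2 * \<alpha> - 1) else 0)"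
proof (cases "i = j \<and> i \<noteq> 0")
  case True
  have "x $ 0 > 0" using assms by (simp add: spacetime_def)
  then have "((\<lambda>t. t powr (2 * \<alpha>)) has_real_derivative 2 * \<alpha> * (x $ 0) powr (2 * \<alpha> - 1)) (at (x $ 0))"
    by (rule has_real_derivative_powr)
  from pd_time_function[OF assms this] show ?thesis
    using True by (auto simp: power_law_metric_def)
next
  case False
  then consider "i \<noteq> j" | "i = 0" "j = 0" by auto
  then show ?thesis
    by cases (simp_all add: power_law_metric_def pd_spacetime_const[OF assms])
qed

lemma christoffel_power_law:
  assumes "x \<in> spacetime"
  shows "christoffel (power_law_metric \<alpha>) l \<mu> \<nu> x =
    (if l = 0 then (if \<mu> = \<nu> \<and> \<mu> \<noteq> 0 then \<alpha> * (x $ 0) powr (2 * \<alpha> - 1) else 0)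
     else if \<mu> = 0 \<and> \<nu> = l \<or> \<nu> = 0 \<and> \<mu> = l then \<alpha> / x $ 0 else 0)"
proof -
  have pos: "x $ 0 > 0" using assms by (simp add: spacetime_def)
  \<comment> \<open>Up to constants this is the inverse metric times the time derivative of the
    metric; it is the source of the expansion rate \<open>\<alpha> / x $ 0\<close>.\<close>
  have *: "(x $ 0) powr (- (2 * \<alpha>)) * (x $ 0) powr (2 * \<alpha> - 1) = 1 / x $ 0"
    using powr_add[of "x $ 0" "- (2 * \<alpha>)" "2 * \<alpha> - 1"] pos
    by (simp add: powr_minus_divide)
  define G where "G \<sigma> = pd spacetime \<mu> (\<lambda>y. power_law_metric \<alpha> y $ \<sigma> $ \<nu>) x
        + pd spacetime \<nu> (\<lambda>y. power_law_metric \<alpha> y $ \<sigma> $ \<mu>) x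
        - pd spacetime \<sigma> (\<lambda>y. power_law_metric \<alpha> y $ \<mu> $ \<nu>) x" for \<sigma>
  define c where "c = (if l = 0 then -1 else (x $ 0) powr (- (2 * \<alpha>)))"
  have summand: "matrix_inv (power_law_metric \<alpha> x) $ l $ \<sigma> * G \<sigma> = (if l = \<sigma> then c * G l else 0)" for \<sigma>
    by (cases "l = \<sigma>") (simp_all add: power_law_metric_inv[OF assms] c_def)
  have "christoffel (power_law_metric \<alpha>) l \<mu> \<nu> x = 1/2 * (\<Sum>\<sigma>\<in>UNIV. if l = \<sigma> then c * G l else 0)"
    unfolding christoffel_def G_def[symmetric] summand ..
  also have "\<dots> = c * G l / 2"
    by simp
  also have "\<dots> = (if l = 0 then (if \<mu> = \<nu> \<and> \<mu> \<noteq> 0 then \<alpha> * (x $ 0) powr (2 * \<alpha> - 1) else 0)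
     else if \<mu> = 0 \<and> \<nu> = l \<or> \<nu> = 0 \<and> \<mu> = l then \<alpha> / x $ 0 else 0)"
  proof (cases "l = 0")
    case True
    then show ?thesis by (auto simp: c_def G_def pd_power_law_metric[OF assms])
  next
    case False
    have "c * (2 * \<alpha> * (x $ 0) powr (2 * \<alpha> - 1)) = \<alpha> * 2 / x $ 0"
      using arg_cong[OF *, of "(*) (2 * \<alpha>)"] False by (simp add: c_def mult.left_commute)
    then show ?thesis
      using False by (auto simp: G_def pd_power_law_metric[OF assms])
  qed
  finally show ?thesis .
qed

section \<open>The dust momentum equation in coordinates\<close>

text \<open>The numeral type \<open>4\<close> is the integers modulo 4, so the index that
  \<open>sum_4\<close> calls 4 is the time index 0.\<close>

lemma sum_4_zero: "sum f (UNIV :: 4 set) = f 0 + f 1 + f 2 + f 3"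
proof -
  have "(4::4) = 0" by simp
  then have "f 4 = f 0" by (rule arg_cong)
  then show ?thesis unfolding sum_4 by (simp add: ac_simps)
qed

lemma forall_4_zero: "(\<forall>i::4. P i) \<longleftrightarrow> P 0 \<and> P 1 \<and> P 2 \<and> P 3"
proof -
  have "(4::4) = 0" by simp
  then have "P 4 = P 0" by (rule arg_cong)
  then show ?thesis unfolding forall_4 by auto
qed

text \<open>After cancelling \<open>\<rho> x > 0\<close>, the symbols with lower indices (0, i) and
  (i, 0) contribute equally, whence the factor 2. This damping term is exactly what the weight t^(2
  alpha) absorbs.\<close>

lemma dust_momentum_equation:
  assumes "fluid_solution (power_law_metric \<alpha>) 0 \<rho> u" "x \<in> spacetime" "i \<noteq> 0"
  shows "(\<Sum>\<mu>\<in>UNIV. u x $ \<mu> * pd spacetime \<mu> (\<lambda>y. u y $ i) x) + 2 * \<alpha> / x $ 0 * u x $ 0 * u x $ i = 0"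
proof -
  let ?g = "power_law_metric \<alpha>"
  have "\<rho> x > 0" and e: "euler_equations ?g (\<lambda>y. 0 * \<rho> y) \<rho> u x"
    using assms by (auto simp: fluid_solution_def)
  then have "(\<Sum>\<mu>\<in>UNIV. u x $ \<mu> * cov_deriv ?g u \<mu> i x) = 0"
    by (auto simp: euler_equations_def pd_spacetime_const[OF assms(2)])
  moreover have "(\<Sum>\<mu>\<in>UNIV. u x $ \<mu> * (\<Sum>l\<in>UNIV. christoffel ?g i \<mu> l x * u x $ l))
      = 2 * \<alpha> / x $ 0 * u x $ 0 * u x $ i"
  proof -
    have "christoffel ?g i \<mu> l x * u x $ l = (if l = i then if \<mu> = 0 then \<alpha> / x $ 0 * u x $ i else 0 else 0)
        + (if l = 0 then if \<mu> = i then \<alpha> / x $ 0 * u x $ 0 else 0 else 0)" for \<mu> l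
      using assms(3) by (simp add: christoffel_power_law[OF assms(2)])
    then have "(\<Sum>\<mu>\<in>UNIV. u x $ \<mu> * (\<Sum>l\<in>UNIV. christoffel ?g i \<mu> l x * u x $ l)) =
       (\<Sum>\<mu>\<in>UNIV. (if \<mu> = 0 then u x $ 0 * (\<alpha> / x $ 0 * u x $ i) else 0)
        + (if \<mu> = i then u x $ i * (\<alpha> / x $ 0 * u x $ 0) else 0))"
      using assms(3) by (intro sum.cong refl) (simp add: sum.distrib)
    also have "\<dots> = 2 * \<alpha> / x $ 0 * u x $ 0 * u x $ i"
      by (simp add: sum.distrib)
    finally show ?thesis .
  qed
  ultimately show ?thesis
    by (simp add: cov_deriv_def distrib_left sum.distrib)
qed

section \<open>Gronwall's inequality and Lipschitz dependence of the velocity on the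
  momentum\<close>

text \<open>The integrating factor makes exp(-C t) W nonincreasing from 0. At the endpoints
  one-sided derivatives suffice, since there only continuity matters.\<close>

lemma gronwall_zero:
  fixes W W' :: "real \<Rightarrow> real"
  assumes deriv: "\<And>t. t \<in> {a..b} \<Longrightarrow> (W has_real_derivative W' t) (at t within {a..b})"
    and le: "\<And>t. t \<in> {a..b} \<Longrightarrow> W' t \<le> C * W t"
    and init: "W a = 0" and nonneg: "\<And>t. t \<in> {a..b} \<Longrightarrow> 0 \<le> W t"
    and t: "t \<in> {a..b}"
  shows "W t = 0"
proof -
  define E where "E s = exp (- (C * s)) * W s" for s
  define E' where "E' s = exp (- (C * s)) * (W' s - C * W s)" for s
  have E: "(E has_real_derivative E' s) (at s within {a..b})" if "s \<in> {a..b}" for s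
    unfolding E_def E'_def using deriv[OF that]
    by (auto intro!: derivative_eq_intros simp: algebra_simps)
  have "E t \<le> E a"
  proof (rule DERIV_nonpos_imp_decreasing_open[of a t E])
    show "a \<le> t" using t by simp
    show "\<exists>y. (E has_real_derivative y) (at s) \<and> y \<le> 0" if "a < s" "s < t" for s
    proof (intro exI conjI)
      show "(E has_real_derivative E' s) (at s)"
        using E[of s] that t by (simp add: at_within_Icc_at)
      show "E' s \<le> 0"
        using le[of s] that t by (auto simp: E'_def mult_nonneg_nonpos)
    qed
    have "continuous_on {a..b} E" by (rule DERIV_continuous_on[OF E])
    then show "continuous_on {a..t} E"
      by (rule continuous_on_subset) (use t in auto)
  qed
  then have "exp (- (C * t)) * W t \<le> 0" by (simp add: E_def init)
  then have "W t \<le> 0" by (simp add: mult_le_0_iff)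
  with nonneg[OF t] show ?thesis by simp
qed

text \<open>Here \<open>a\<close> stands for t^(-2 alpha) and P for the comoving momentum, so
  \<open>a * P1 / e\<close> is the coordinate velocity u^1 / u^0, and \<open>n\<close> is the
  distance of P from (p, 0, 0). Changing the numerator and changing the energy cost at most
  \<open>n\<close> each, which makes the factor 2.\<close>

lemma velocity_diff_le:
  fixes a p P1 P2 P3 :: real
  assumes "0 < a" "a \<le> 1"
  defines "e \<equiv> sqrt (1 + a * (P1\<^sup>2 + P2\<^sup>2 + P3\<^sup>2))"
    and "n \<equiv> sqrt ((P1 - p)\<^sup>2 + P2\<^sup>2 + P3\<^sup>2)"
  shows "\<bar>a * p / sqrt (1 + a * p\<^sup>2) - a * P1 / e\<bar> \<le> 2 * n"
proof -
  define E where "E = sqrt (1 + a * p\<^sup>2)"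
  have e2: "e\<^sup>2 = 1 + a * (P1\<^sup>2 + P2\<^sup>2 + P3\<^sup>2)" and E2: "E\<^sup>2 = 1 + a * p\<^sup>2"
    using assms(1) by (simp_all add: e_def E_def)
  have e1: "e \<ge> 1" and E1: "E \<ge> 1"
    using assms(1) by (simp_all add: e_def E_def)
  have n1: "\<bar>p - P1\<bar> \<le> n"
    unfolding n_def by (rule real_le_rsqrt) (simp add: power2_commute)
  have n0: "n \<ge> 0" using n1 by linarith
  (* Cauchy-Schwarz for (1, sqrt a P) and (1, sqrt a (p, 0, 0)) *)
  have "\<bar>1 + a * p * P1\<bar> \<le> e * E"
  proof (rule power2_le_imp_le)
    have "(e * E)\<^sup>2 - (1 + a * p * P1)\<^sup>2 = a * (P1 - p)\<^sup>2 + a * (P2\<^sup>2 + P3\<^sup>2) * (1 + a * p\<^sup>2)"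
      unfolding power_mult_distrib e2 E2 by (simp add: power2_eq_square algebra_simps)
    also have "\<dots> \<ge> 0" using assms(1) by simp
    finally show "\<bar>1 + a * p * P1\<bar>\<^sup>2 \<le> (e * E)\<^sup>2" by simp
    show "0 \<le> e * E" using e1 E1 by simp
  qed
  \<comment> \<open>With the cross term bounded from below, the ones in \<open>e\<^sup>2\<close> and
    \<open>E\<^sup>2\<close> cancel and \<open>a\<close> times the squared distance remains: the
    energy is Lipschitz in the momentum.\<close>
  then have "(e - E)\<^sup>2 \<le> a * ((P1 - p)\<^sup>2 + P2\<^sup>2 + P3\<^sup>2)"
    using e2 E2 by (simp add: power2_eq_square algebra_simps abs_le_iff)
  also have "\<dots> \<le> 1 * ((P1 - p)\<^sup>2 + P2\<^sup>2 + P3\<^sup>2)"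
    using assms(2) by (intro mult_right_mono) auto
  finally have eE: "\<bar>e - E\<bar> \<le> n"
    unfolding n_def by (intro real_le_rsqrt) simp
  have "(a * p)\<^sup>2 \<le> E\<^sup>2"
  proof -
    have "(a * p)\<^sup>2 = a * (a * p\<^sup>2)" by (simp add: power2_eq_square)
    also have "\<dots> \<le> 1 * (a * p\<^sup>2)" using assms(1,2) by (intro mult_right_mono) auto
    finally show ?thesis by (simp add: E2)
  qed
  then have apE: "\<bar>a * p\<bar> \<le> E" using E1 abs_le_square_iff[of "a * p" E] by simp
  have "a * p / E - a * P1 / e = a * (p - P1) / e + (a * p / E) * ((e - E) / e)"
    using e1 E1 by (simp add: field_simps)
  also have "\<bar>\<dots>\<bar> \<le> \<bar>a * (p - P1) / e\<bar> + \<bar>(a * p / E) * ((e - E) / e)\<bar>"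
    by (rule abs_triangle_ineq)
  also have "\<bar>a * (p - P1) / e\<bar> \<le> n"
  proof -
    have "\<bar>a * (p - P1)\<bar> \<le> 1 * n"
      unfolding abs_mult using assms(1,2) n1 n0 by (intro mult_mono) auto
    also have "\<dots> \<le> n * e" using e1 n0 by (simp add: mult_le_cancel_left1)
    finally show ?thesis using e1 by (simp add: divide_le_eq abs_divide)
  qed
  also have "\<bar>(a * p / E) * ((e - E) / e)\<bar> \<le> 1 * n"
    unfolding abs_mult
  proof (intro mult_mono)
    show "\<bar>a * p / E\<bar> \<le> 1" using apE E1 by (simp add: abs_divide)
    have "\<bar>e - E\<bar> \<le> n * 1" using eE by simp
    also have "\<dots> \<le> n * e" using e1 n0 by (intro mult_left_mono) auto
    finally show "\<bar>(e - E) / e\<bar> \<le> n" using e1 by (simp add: abs_divide divide_le_eq)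
  qed auto
  finally show ?thesis by (simp add: E_def)
qed

section \<open>Conservation of momentum along explicit curves\<close>

text \<open>Written as a combination of axis vectors instead of through \<open>event\<close>, so
  that continuity and derivative rules apply term by term.\<close>

definition plane_event :: "real \<Rightarrow> real \<Rightarrow> real^4" where
  "plane_event t x = t *\<^sub>R axis 0 1 + x *\<^sub>R axis 1 1"

lemma plane_event_simps [simp]:
  "plane_event t x $ 0 = t" "plane_event t x $ 1 = x" "plane_event t x $ 2 = 0" "plane_event t x $ 3 = 0"
  by (simp_all add: plane_event_def axis_eq_if)

lemma plane_event_in_spacetime: "1 \<le> t \<Longrightarrow> plane_event t x \<in> spacetime"
  by (simp add: spacetime_def)

lemma event_axis: "event t (x *\<^sub>R axis 1 1) = plane_event t x"
  by (simp add: vec_eq_iff forall_4_zero event_def axis_eq_if)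

text \<open>The diagonal metric turns the normalization into an equation for the square of u^0, and
  future direction selects the positive root. In particular u^0 >= 1, so dividing by it is
  harmless.\<close>

lemma energy_component:
  assumes "fluid_solution (power_law_metric \<alpha>) K \<rho> u" "y \<in> spacetime"
  shows "u y $ 0 = sqrt (1 + (y $ 0) powr (2 * \<alpha>) * ((u y $ 1)\<^sup>2 + (u y $ 2)\<^sup>2 + (u y $ 3)\<^sup>2))"
proof -
  let ?g = "power_law_metric \<alpha> y"
  have fu: "future_unit (power_law_metric \<alpha>) y (u y)"
    using assms by (simp add: fluid_solution_def)
  have "(\<Sum>\<nu>\<in>UNIV. ?g $ \<mu> $ \<nu> * u y $ \<mu> * u y $ \<nu>) = ?g $ \<mu> $ \<mu> * (u y $ \<mu>)\<^sup>2" for \<mu>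
  proof -
    have "?g $ \<mu> $ \<nu> * u y $ \<mu> * u y $ \<nu> = (if \<mu> = \<nu> then ?g $ \<mu> $ \<mu> * (u y $ \<mu>)\<^sup>2 else 0)" for \<nu>
      by (simp add: power_law_metric_def power2_eq_square)
    then show ?thesis by simp
  qed
  then have "(\<Sum>\<mu>\<in>UNIV. ?g $ \<mu> $ \<mu> * (u y $ \<mu>)\<^sup>2) = -1"
    using fu by (simp add: future_unit_def)
  then have "(u y $ 0)\<^sup>2 = 1 + (y $ 0) powr (2 * \<alpha>) * ((u y $ 1)\<^sup>2 + (u y $ 2)\<^sup>2 + (u y $ 3)\<^sup>2)"
    by (simp add: sum_4_zero power_law_metric_def algebra_simps)
  then show ?thesis using fu by (simp add: future_unit_def real_sqrt_unique)
qed

lemma plane_event_has_derivative: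
  assumes "(x has_real_derivative v) (at t within S)"
  shows "((\<lambda>s. plane_event s (x s)) has_derivative (\<lambda>s. s *\<^sub>R plane_event 1 v)) (at t within S)"
proof -
  have "(x has_derivative (\<lambda>s. s * v)) (at t within S)"
    using assms by (simp add: has_field_derivative_def mult_commute_abs)
  then show ?thesis
    unfolding plane_event_def
    by (auto intro!: derivative_eq_intros simp: algebra_simps)
qed

text \<open>Since \<open>f\<close> is differentiable only within the half-space, the chain rule is
  applied with the image of the curve as domain; this covers t = 1 as well.\<close>

lemma derivative_along_curve:
  fixes f :: "real^4 \<Rightarrow> real"
  assumes x: "(x has_real_derivative v) (at t within {1..T})" and t: "t \<in> {1..T}"
    and f: "f differentiable (at (plane_event t (x t)) within spacetime)"
  shows "((\<lambda>s. f (plane_event s (x s))) has_real_derivative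
     pd spacetime 0 f (plane_event t (x t)) + v * pd spacetime 1 f (plane_event t (x t)))
     (at t within {1..T})"
proof -
  let ?c = "\<lambda>s. plane_event s (x s)"
  have "?c ` {1..T} \<subseteq> spacetime" by (auto simp: plane_event_in_spacetime)
  then have "(f has_derivative (\<lambda>h. \<Sum>i\<in>UNIV. h $ i * pd spacetime i f (?c t))) (at (?c t) within ?c ` {1..T})"
    using has_derivative_subset[OF has_derivative_pd_spacetime[OF f]] by blast
  note has_derivative_in_compose[OF plane_event_has_derivative[OF x] this]
  then show ?thesis
    unfolding has_field_derivative_def
    by (rule has_derivative_eq_rhs) (simp add: fun_eq_iff sum_4_zero algebra_simps)
qed

lemma differentiable_component:
  assumes "u differentiable (at x within S)"
  shows "(\<lambda>y. u y $ i) differentiable (at x within S)"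
  using assms bounded_linear.has_derivative[OF bounded_linear_vec_nth]
  unfolding differentiable_def by blast

text \<open>Continuity of the derivatives up to time \<open>T\<close> enters here: on a compact
  piece of a curve they are bounded, and the bound becomes part of the Gronwall constant.\<close>

lemma C1_on_pd_bounded_along_curve:
  fixes u :: "real^4 \<Rightarrow> real^4"
  assumes u: "C1_on spacetime u" and x: "continuous_on {1..T} x"
  shows "\<exists>B\<ge>0. \<forall>i k. \<forall>t\<in>{1..T}. \<bar>pd spacetime i (\<lambda>y. u y $ k) (plane_event t (x t))\<bar> \<le> B"
proof -
  let ?c = "\<lambda>t. plane_event t (x t)"
  have c: "continuous_on {1..T} ?c"
    unfolding plane_event_def by (intro continuous_intros x)
  have "\<exists>B. \<forall>t\<in>{1..T}. norm (pd spacetime i u (?c t)) \<le> B" for i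
  proof -
    have "continuous_on {1..T} (\<lambda>t. pd spacetime i u (?c t))"
      using u by (intro continuous_on_compose2[OF _ c, of spacetime])
        (auto simp: C1_on_def plane_event_in_spacetime)
    then have "compact ((\<lambda>t. pd spacetime i u (?c t)) ` {1..T})"
      by (intro compact_continuous_image) auto
    then show ?thesis by (auto dest!: compact_imp_bounded simp: bounded_iff)
  qed
  then obtain B where B: "\<And>i t. t \<in> {1..T} \<Longrightarrow> norm (pd spacetime i u (?c t)) \<le> B i"
    by metis
  show ?thesis
  proof (intro exI[of _ "\<Sum>i\<in>UNIV. \<bar>B i\<bar>"] conjI allI ballI)
    fix i k t assume t: "t \<in> {1..T}"
    have "u differentiable (at (?c t) within spacetime)"
      using u t by (simp add: C1_on_def differentiable_on_def plane_event_in_spacetime)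
    then have "\<bar>pd spacetime i (\<lambda>y. u y $ k) (?c t)\<bar> \<le> norm (pd spacetime i u (?c t))"
      using t by (simp add: pd_spacetime_component plane_event_in_spacetime component_le_norm_cart)
    also have "\<dots> \<le> \<bar>B i\<bar>" using B[OF t, of i] by simp
    also have "\<dots> \<le> (\<Sum>i\<in>UNIV. \<bar>B i\<bar>)" by (intro member_le_sum) auto
    finally show "\<bar>pd spacetime i (\<lambda>y. u y $ k) (?c t)\<bar> \<le> (\<Sum>i\<in>UNIV. \<bar>B i\<bar>)" .
  qed (simp add: sum_nonneg)
qed

(* The curve x is explicit, so no characteristic has to be constructed: the deviation W of the
   momentum from (p, 0, 0) along x satisfies W' \<le> C W because the mismatch between the velocity of
   the curve and that of the fluid is Lipschitz in the momentum. *)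
lemma momentum_conserved:
  assumes sol: "fluid_solution (power_law_metric \<alpha>) 0 \<rho> u" and "0 \<le> \<alpha>"
    and x: "\<And>t. t \<in> {1..T} \<Longrightarrow>
      (x has_real_derivative t powr (- (2 * \<alpha>)) * p / sqrt (1 + t powr (- (2 * \<alpha>)) * p\<^sup>2)) (at t within {1..T})"
    and init: "u (plane_event 1 (x 1)) $ 1 = p" "u (plane_event 1 (x 1)) $ 2 = 0" "u (plane_event 1 (x 1)) $ 3 = 0"
    and t: "t \<in> {1..T}"
  shows "t powr (2 * \<alpha>) * u (plane_event t (x t)) $ 1 = p"
proof -
  define c where "c s = plane_event s (x s)" for s
  define D where "D i k s = pd spacetime k (\<lambda>y. u y $ i) (c s)" for i k s
  define v where "v s = s powr (- (2 * \<alpha>)) * p / sqrt (1 + s powr (- (2 * \<alpha>)) * p\<^sup>2)" for s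
  \<comment> \<open>The comoving momentum minus its target (p, 0, 0). In \<open>h'\<close> the
    momentum equation has eliminated the time derivative, so each spatial derivative is multiplied
    only by the mismatch between the velocities of curve and fluid.\<close>
  define h where "h i s = s powr (2 * \<alpha>) * u (c s) $ i - (if i = 1 then p else 0)" for i s
  define h' where "h' i s = s powr (2 * \<alpha>) * ((v s - u (c s) $ 1 / u (c s) $ 0) * D i 1 s
      - u (c s) $ 2 / u (c s) $ 0 * D i 2 s - u (c s) $ 3 / u (c s) $ 0 * D i 3 s)" for i s
  have c: "c s \<in> spacetime" if "s \<in> {1..T}" for s
    using that by (simp add: c_def plane_event_in_spacetime)
  have u: "C1_on spacetime u" using sol by (simp add: fluid_solution_def)
  have "continuous_on {1..T} x" by (rule DERIV_continuous_on[OF x])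
  then obtain B where B0: "B \<ge> 0"
    and B: "\<forall>i k. \<forall>s\<in>{1..T}. \<bar>pd spacetime i (\<lambda>y. u y $ k) (plane_event s (x s))\<bar> \<le> B"
    using C1_on_pd_bounded_along_curve[OF u, of T x] by blast
  have B: "\<bar>D i k s\<bar> \<le> B" if "s \<in> {1..T}" for i k s
    using B that by (simp add: D_def c_def)
  \<comment> \<open>The squared deviation, because the norm itself need not be differentiable where
    it vanishes.\<close>
  define W where "W s = (h 1 s)\<^sup>2 + (h 2 s)\<^sup>2 + (h 3 s)\<^sup>2" for s
  define W' where "W' s = 2 * (h 1 s * h' 1 s + h 2 s * h' 2 s + h 3 s * h' 3 s)" for s
  have energy: "u (c s) $ 0 = sqrt (1 + s powr (2 * \<alpha>) * ((u (c s) $ 1)\<^sup>2 + (u (c s) $ 2)\<^sup>2 + (u (c s) $ 3)\<^sup>2))"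
    if "s \<in> {1..T}" for s
    using energy_component[OF sol c[OF that]] by (simp add: c_def)
  have u0: "u (c s) $ 0 \<ge> 1" if "s \<in> {1..T}" for s
    using energy[OF that] by simp
  have h: "(h i has_real_derivative h' i s) (at s within {1..T})" if s: "s \<in> {1..T}" and i: "i \<noteq> 0" for i s
  proof -
    have "(\<lambda>y. u y $ i) differentiable (at (c s) within spacetime)"
      using u c[OF s] by (intro differentiable_component) (simp add: C1_on_def differentiable_on_def)
    from derivative_along_curve[OF x[OF s] s this[unfolded c_def]]
    have 1: "((\<lambda>s. u (c s) $ i) has_real_derivative D i 0 s + v s * D i 1 s) (at s within {1..T})"
      by (simp add: c_def D_def v_def)
    have sp: "s > 0" using s by simp
    have pw: "s powr (2 * \<alpha> - 1) = s powr (2 * \<alpha>) / s" using sp by (simp add: powr_diff)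
    have "(h i has_real_derivative 2 * \<alpha> * s powr (2 * \<alpha> - 1) * u (c s) $ i
        + s powr (2 * \<alpha>) * (D i 0 s + v s * D i 1 s)) (at s within {1..T})"
      unfolding h_def
      using DERIV_diff[OF DERIV_mult[OF has_field_derivative_at_within[OF has_real_derivative_powr[OF sp]] 1] DERIV_const]
      by (rule DERIV_cong) (simp add: algebra_simps)
    \<comment> \<open>The momentum equation is solved for \<open>D i 0 s\<close>; its term with
      \<open>2 * \<alpha> / s\<close> cancels the derivative of the weight.\<close>
    moreover have "2 * \<alpha> * s powr (2 * \<alpha> - 1) * u (c s) $ i
        + s powr (2 * \<alpha>) * (D i 0 s + v s * D i 1 s) = h' i s"
    proof -
      have "u (c s) $ 0 * D i 0 s = - u (c s) $ 1 * D i 1 s - u (c s) $ 2 * D i 2 s - u (c s) $ 3 * D i 3 s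
         - 2 * \<alpha> / s * u (c s) $ 0 * u (c s) $ i"
        using dust_momentum_equation[OF sol c[OF s] i] by (simp add: sum_4_zero D_def c_def algebra_simps)
      then have "D i 0 s = (- u (c s) $ 1 * D i 1 s - u (c s) $ 2 * D i 2 s - u (c s) $ 3 * D i 3 s
         - 2 * \<alpha> / s * u (c s) $ 0 * u (c s) $ i) / u (c s) $ 0"
        using u0[OF s] by (simp add: nonzero_eq_divide_eq mult.commute)
      also have "\<dots> = - u (c s) $ 1 / u (c s) $ 0 * D i 1 s - u (c s) $ 2 / u (c s) $ 0 * D i 2 s
          - u (c s) $ 3 / u (c s) $ 0 * D i 3 s - 2 * \<alpha> / s * u (c s) $ i"
        using u0[OF s] by (simp add: diff_divide_distrib)
      finally have D0: "D i 0 s = \<dots>" .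
      show ?thesis
        unfolding h'_def pw D0 by (simp add: algebra_simps)
    qed
    ultimately show ?thesis by simp
  qed
  have h'_le: "\<bar>h' i s\<bar> \<le> T powr (2 * \<alpha>) * (4 * B * sqrt (W s))" if s: "s \<in> {1..T}" for i s
  proof -
    define a where "a = s powr (- (2 * \<alpha>))"
    have sp: "s > 0" using s by simp
    have inv: "a * s powr (2 * \<alpha>) = 1" using sp by (simp add: a_def powr_minus)
    have a: "0 < a" "a \<le> 1"
      using s \<open>0 \<le> \<alpha>\<close> ge_one_powr_ge_zero[of s "2 * \<alpha>"] by (auto simp: a_def powr_minus inverse_le_1_iff)
    define P where "P k = s powr (2 * \<alpha>) * u (c s) $ k" for k
    have uP: "u (c s) $ k = a * P k" for k
      using inv by (simp add: P_def mult.assoc[symmetric])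
    have "s powr (2 * \<alpha>) * (a * q)\<^sup>2 = a * q\<^sup>2" for q
      using inv by (simp add: power2_eq_square algebra_simps)
    then have e: "u (c s) $ 0 = sqrt (1 + a * ((P 1)\<^sup>2 + (P 2)\<^sup>2 + (P 3)\<^sup>2))"
      unfolding energy[OF s] by (simp add: uP distrib_left)
    have W: "W s = (P 1 - p)\<^sup>2 + (P 2)\<^sup>2 + (P 3)\<^sup>2"
      by (simp add: W_def h_def P_def)
    have 1: "\<bar>v s - u (c s) $ 1 / u (c s) $ 0\<bar> \<le> 2 * sqrt (W s)"
      using velocity_diff_le[OF a, of p "P 1" "P 2" "P 3"] unfolding e[symmetric] W[symmetric]
      by (simp add: v_def uP a_def[symmetric])
    \<comment> \<open>The target values of P 2 and P 3 are 0, so these components are themselves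
      part of the deviation.\<close>
    have transversal: "\<bar>u (c s) $ k / u (c s) $ 0\<bar> \<le> sqrt (W s)" if "k = 2 \<or> k = 3" for k
    proof -
      have "\<bar>u (c s) $ k / u (c s) $ 0\<bar> \<le> \<bar>u (c s) $ k\<bar>"
        using u0[OF s] by (simp add: abs_divide divide_le_eq mult_le_cancel_left1)
      also have "\<dots> \<le> \<bar>P k\<bar>" using a by (simp add: uP abs_mult mult_left_le_one_le)
      also have "\<dots> \<le> sqrt (W s)"
        using that by (intro real_le_rsqrt) (auto simp: W)
      finally show ?thesis .
    qed
    have W0: "0 \<le> sqrt (W s)" by (simp add: W)
    have "\<bar>(v s - u (c s) $ 1 / u (c s) $ 0) * D i 1 s
      - u (c s) $ 2 / u (c s) $ 0 * D i 2 s - u (c s) $ 3 / u (c s) $ 0 * D i 3 s\<bar>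
      \<le> \<bar>(v s - u (c s) $ 1 / u (c s) $ 0) * D i 1 s\<bar>
      + \<bar>u (c s) $ 2 / u (c s) $ 0 * D i 2 s\<bar> + \<bar>u (c s) $ 3 / u (c s) $ 0 * D i 3 s\<bar>"
      by linarith
    \<comment> \<open>The 4 of the bound is 2 + 1 + 1: two from \<open>velocity_diff_le\<close>, one
      from each transversal velocity.\<close>
    also have "\<dots> \<le> 2 * sqrt (W s) * B + sqrt (W s) * B + sqrt (W s) * B"
      unfolding abs_mult using 1 transversal B[OF s] W0 B0 by (intro add_mono mult_mono) auto
    also have "\<dots> = 4 * B * sqrt (W s)" by simp
    finally have "\<bar>h' i s\<bar> \<le> s powr (2 * \<alpha>) * (4 * B * sqrt (W s))"
      unfolding h'_def abs_mult by (simp add: mult_left_mono)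
    also have "\<dots> \<le> T powr (2 * \<alpha>) * (4 * B * sqrt (W s))"
      using s \<open>0 \<le> \<alpha>\<close> B0 W0 by (intro mult_right_mono powr_mono2) auto
    finally show ?thesis .
  qed
  \<comment> \<open>24 = 2 * 3 * 4: the factor 2 from differentiating squares, three components, and
    the 4 of \<open>h'_le\<close>.\<close>
  have "W t = 0"
  proof (rule gronwall_zero[of 1 T W W' "24 * (T powr (2 * \<alpha>) * B)", OF _ _ _ _ t])
    fix s assume s: "s \<in> {1..T}"
    show "(W has_real_derivative W' s) (at s within {1..T})"
      unfolding W_def W'_def
      using DERIV_add[OF DERIV_add[OF DERIV_power[OF h[OF s]] DERIV_power[OF h[OF s]]] DERIV_power[OF h[OF s]]]
      by (rule DERIV_cong) (simp_all add: algebra_simps)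
    show "0 \<le> W s" by (simp add: W_def)
    have "h i s * h' i s \<le> T powr (2 * \<alpha>) * (4 * B) * W s" if "i \<in> {1, 2, 3}" for i
    proof -
      have "h i s * h' i s \<le> \<bar>h i s\<bar> * \<bar>h' i s\<bar>"
        using abs_ge_self[of "h i s * h' i s"] by (simp add: abs_mult)
      also have "\<dots> \<le> sqrt (W s) * (T powr (2 * \<alpha>) * (4 * B * sqrt (W s)))"
        using that by (intro mult_mono h'_le s real_le_rsqrt) (auto simp: W_def)
      also have "\<dots> = T powr (2 * \<alpha>) * (4 * B) * (sqrt (W s) * sqrt (W s))"
        by (simp only: ac_simps)
      also have "\<dots> = T powr (2 * \<alpha>) * (4 * B) * W s"
        using \<open>0 \<le> W s\<close> by simp
      finally show ?thesis .
    qed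
    from this[of 1] this[of 2] this[of 3]
    show "W' s \<le> 24 * (T powr (2 * \<alpha>) * B) * W s"
      by (simp add: W'_def)
  next
    show "W 1 = 0" using init by (simp add: W_def h_def c_def)
  qed
  then have "h 1 t = 0" by (simp add: W_def add_nonneg_eq_0_iff)
  then show ?thesis by (simp add: h_def c_def)
qed

(* Families in a parameter e, closed under d/ds and containing the components of the initial
   velocity.  Uniform convergence as e \<rightarrow> 0 is inherited along the generation, hence holds at once
   for the derivatives of every order. *)
inductive trig_hyp :: "(real \<Rightarrow> real \<Rightarrow> real) \<Rightarrow> bool" where
  const: "trig_hyp (\<lambda>e s. c)"
| param: "trig_hyp (\<lambda>e s. e)"
| sin: "trig_hyp (\<lambda>e s. sin s)"
| cos: "trig_hyp (\<lambda>e s. cos s)"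
| cosh: "trig_hyp (\<lambda>e s. cosh (e * sin s))"
| sinh: "trig_hyp (\<lambda>e s. sinh (e * sin s))"
| add: "trig_hyp f \<Longrightarrow> trig_hyp g \<Longrightarrow> trig_hyp (\<lambda>e s. f e s + g e s)"
| mult: "trig_hyp f \<Longrightarrow> trig_hyp g \<Longrightarrow> trig_hyp (\<lambda>e s. f e s * g e s)"

section \<open>Derivatives, bounds and uniform limits of the generated families\<close>

text \<open>One family \<open>f'\<close> serves all parameters. The chain rule brings out the factor
  \<open>e * cos s\<close>, which is why the parameter and the cosine are generators.\<close>

lemma trig_hyp_derivative:
  assumes "trig_hyp f"
  shows "\<exists>f'. trig_hyp f' \<and> (\<forall>e s. (f e has_real_derivative f' e s) (at s))"
  using assms
proof induction
  case (const c)
  show ?case by (rule exI[of _ "\<lambda>_ _. 0"]) (auto intro: trig_hyp.const)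
next
  case param
  show ?case by (rule exI[of _ "\<lambda>_ _. 0"]) (auto intro: trig_hyp.const)
next
  case sin
  show ?case by (rule exI[of _ "\<lambda>_ s. cos s"]) (auto intro: trig_hyp.cos)
next
  case cos
  \<comment> \<open>The sign is written as a constant factor because negation is not among the
    generating rules.\<close>
  have "trig_hyp (\<lambda>_ s. -1 * sin s)" by (intro trig_hyp.intros)
  then show ?case by (intro exI[of _ "\<lambda>_ s. -1 * sin s"]) (auto intro!: derivative_eq_intros)
next
  case cosh
  have "trig_hyp (\<lambda>e s. e * cos s * sinh (e * sin s))" by (intro trig_hyp.intros)
  then show ?case
    by (intro exI[of _ "\<lambda>e s. e * cos s * sinh (e * sin s)"]) (auto intro!: derivative_eq_intros)
next
  case sinh
  have "trig_hyp (\<lambda>e s. e * cos s * cosh (e * sin s))" by (intro trig_hyp.intros)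
  then show ?case
    by (intro exI[of _ "\<lambda>e s. e * cos s * cosh (e * sin s)"]) (auto intro!: derivative_eq_intros)
next
  case (add f g)
  then obtain f' g' where "trig_hyp f'" "\<And>e s. (f e has_real_derivative f' e s) (at s)"
    "trig_hyp g'" "\<And>e s. (g e has_real_derivative g' e s) (at s)" by blast
  then show ?case
    by (intro exI[of _ "\<lambda>e s. f' e s + g' e s"]) (auto intro: trig_hyp.add DERIV_add)
next
  case (mult f g)
  then obtain f' g' where f: "trig_hyp f'" "\<And>e s. (f e has_real_derivative f' e s) (at s)"
    and g: "trig_hyp g'" "\<And>e s. (g e has_real_derivative g' e s) (at s)" by blast
  have "trig_hyp (\<lambda>e s. f' e s * g e s + g' e s * f e s)"
    by (intro trig_hyp.intros mult.hyps f g)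
  then show ?case
    by (intro exI[of _ "\<lambda>e s. f' e s * g e s + g' e s * f e s"]) (auto intro: DERIV_mult f g)
qed

text \<open>Uniform limits can be multiplied when the limits are bounded, so the bound is wanted at
  parameter 0, where the hyperbolic generators reduce to the constants 1 and 0.\<close>

lemma trig_hyp_bounded:
  assumes "trig_hyp f"
  shows "bounded (range (f 0))"
proof -
  have "\<exists>B. \<forall>s. \<bar>f 0 s\<bar> \<le> B"
    using assms
  proof induction
    case (add f g)
    then obtain B C where "\<forall>s. \<bar>f 0 s\<bar> \<le> B" "\<forall>s. \<bar>g 0 s\<bar> \<le> C"
      by blast
    then show ?case
      by (intro exI[of _ "B + C"]) (auto intro!: order_trans[OF abs_triangle_ineq] add_mono)
  next
    case (mult f g)
    then obtain B C where *: "\<forall>s. \<bar>f 0 s\<bar> \<le> B" "\<forall>s. \<bar>g 0 s\<bar> \<le> C"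
      by blast
    have "0 \<le> B" using *(1)[rule_format, of 0] by simp
    then show ?case
      using * by (intro exI[of _ "B * C"]) (auto simp: abs_mult intro!: mult_mono)
  qed (auto intro: abs_sin_le_one abs_cos_le_one)
  then show ?thesis by (auto simp: bounded_iff)
qed

lemma uniform_limit_dominated:
  fixes f :: "nat \<Rightarrow> 'a \<Rightarrow> real"
  assumes "b \<longlonglongrightarrow> 0" "\<And>n x. x \<in> S \<Longrightarrow> \<bar>f n x - l x\<bar> \<le> b n"
  shows "uniform_limit S f l sequentially"
proof (rule uniform_limitI)
  fix e :: real assume "0 < e"
  with assms(1) have "\<forall>\<^sub>F n in sequentially. b n < e" by (rule order_tendstoD)
  then show "\<forall>\<^sub>F n in sequentially. \<forall>x\<in>S. dist (f n x) (l x) < e"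
  proof eventually_elim
    case (elim n)
    then show ?case by (auto simp: dist_real_def intro: le_less_trans[OF assms(2)])
  qed
qed

lemma abs_times_sin_le: "\<bar>e * sin s\<bar> \<le> \<bar>e\<bar>" for e s :: real
  unfolding abs_mult by (simp add: mult_left_le)

text \<open>Since |e sin s| <= |e|, monotonicity of cosh and sinh on the nonnegative axis bounds the
  deviation by a quantity free of \<open>s\<close>, hence uniformly on the whole line.\<close>

lemma trig_hyp_uniform_limit:
  assumes "trig_hyp f" and \<epsilon>: "\<epsilon> \<longlonglongrightarrow> 0"
  shows "uniform_limit UNIV (\<lambda>n. f (\<epsilon> n)) (f 0) sequentially"
  using assms(1)
proof induction
  case param
  show ?case
    by (rule uniform_limit_dominated[of "\<lambda>n. \<bar>\<epsilon> n\<bar>"]) (use \<epsilon> in \<open>auto simp: tendsto_rabs_zero_iff\<close>)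
next
  case cosh
  show ?case
  proof (rule uniform_limit_dominated[of "\<lambda>n. cosh (\<epsilon> n) - 1"])
    show "(\<lambda>n. cosh (\<epsilon> n) - 1) \<longlonglongrightarrow> 0"
      using tendsto_diff[OF tendsto_cosh[OF \<epsilon>] tendsto_const[of 1]] by simp
    fix n s
    have "cosh \<bar>\<epsilon> n * sin s\<bar> \<le> cosh \<bar>\<epsilon> n\<bar>"
      using abs_times_sin_le[of "\<epsilon> n" s] cosh_real_strict_mono[of "\<bar>\<epsilon> n * sin s\<bar>" "\<bar>\<epsilon> n\<bar>"]
      by (cases "\<bar>\<epsilon> n * sin s\<bar> = \<bar>\<epsilon> n\<bar>") auto
    then show "\<bar>cosh (\<epsilon> n * sin s) - cosh (0 * sin s)\<bar> \<le> cosh (\<epsilon> n) - 1"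
      using cosh_real_ge_1[of "\<epsilon> n * sin s"] by simp
  qed
next
  case sinh
  show ?case
  proof (rule uniform_limit_dominated[of "\<lambda>n. sinh \<bar>\<epsilon> n\<bar>"])
    show "(\<lambda>n. sinh \<bar>\<epsilon> n\<bar>) \<longlonglongrightarrow> 0"
      using tendsto_sinh[OF tendsto_rabs_zero[OF \<epsilon>]] by simp
    fix n s
    have "sinh \<bar>\<epsilon> n * sin s\<bar> \<le> sinh \<bar>\<epsilon> n\<bar>"
      unfolding sinh_real_le_iff by (rule abs_times_sin_le)
    then show "\<bar>sinh (\<epsilon> n * sin s) - sinh (0 * sin s)\<bar> \<le> sinh \<bar>\<epsilon> n\<bar>"
      by simp
  qed
next
  case (add f g)
  then show ?case by (intro uniform_limit_intros)
next
  case (mult f g)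
  then show ?case
    by (intro uniform_lim_mult trig_hyp_bounded)
qed (auto intro: uniform_limit_const)

section \<open>Smoothness and smooth convergence of the initial velocities\<close>

lemma pd_plane_symmetric:
  fixes f :: "real \<Rightarrow> 'b::real_normed_vector"
  assumes "(f has_vector_derivative f' (y $ k)) (at (y $ k))"
  shows "((\<lambda>y :: real^'n. f (y $ k)) has_derivative (\<lambda>h. (h $ k) *\<^sub>R f' (y $ k))) (at y)"
    and "pd UNIV i (\<lambda>y :: real^'n. f (y $ k)) y = (if i = k then f' (y $ k) else 0)"
proof -
  have "(f has_derivative (\<lambda>h. h *\<^sub>R f' (y $ k))) (at (y $ k))"
    using assms by (simp add: has_vector_derivative_def)
  from has_derivative_compose[OF bounded_linear_imp_has_derivative[OF bounded_linear_vec_nth] this]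
  show *: "((\<lambda>y :: real^'n. f (y $ k)) has_derivative (\<lambda>h. (h $ k) *\<^sub>R f' (y $ k))) (at y)" .
  show "pd UNIV i (\<lambda>y :: real^'n. f (y $ k)) y = (if i = k then f' (y $ k) else 0)"
    unfolding pd_def frechet_derivative_at[OF *, symmetric] by (simp add: axis_def)
qed

definition velocity_data :: "real \<Rightarrow> real^3 \<Rightarrow> real^4" where
  "velocity_data e y = cosh (e * sin (y $ 1)) *\<^sub>R axis 0 1 - sinh (e * sin (y $ 1)) *\<^sub>R axis 1 1"

text \<open>The common shape of all iterated partial derivatives of \<open>velocity_data\<close>;
  the coefficients are kept as families in \<open>e\<close>, so that one induction treats all
  parameters.\<close>

definition two_velocity :: "(real \<Rightarrow> real \<Rightarrow> real) \<Rightarrow> (real \<Rightarrow> real \<Rightarrow> real) \<Rightarrow> real \<Rightarrow> real \<Rightarrow> real^4" where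
  "two_velocity f g e s = f e s *\<^sub>R axis 0 1 + g e s *\<^sub>R axis 1 1"

lemma two_velocity_derivative:
  assumes "\<And>s. (f e has_real_derivative f' e s) (at s)" "\<And>s. (g e has_real_derivative g' e s) (at s)"
  shows "(two_velocity f g e has_vector_derivative two_velocity f' g' e s) (at s)"
  unfolding two_velocity_def
  by (auto intro!: derivative_eq_intros assms)

lemma velocity_data_eq:
  "velocity_data e = (\<lambda>y. two_velocity (\<lambda>e s. cosh (e * sin s)) (\<lambda>e s. -1 * sinh (e * sin s)) e (y $ 1))"
  by (simp add: velocity_data_def two_velocity_def fun_eq_iff)

lemma pd_two_velocity:
  assumes "trig_hyp f" "trig_hyp g"
  shows "\<exists>f' g'. trig_hyp f' \<and> trig_hyp g' \<and>
    (\<forall>e. pd UNIV i (\<lambda>y :: real^3. two_velocity f g e (y $ 1)) = (\<lambda>y. two_velocity f' g' e (y $ 1)))"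
proof -
  obtain f' g' where f: "trig_hyp f'" "\<And>e s. (f e has_real_derivative f' e s) (at s)"
    and g: "trig_hyp g'" "\<And>e s. (g e has_real_derivative g' e s) (at s)"
    using trig_hyp_derivative[OF assms(1)] trig_hyp_derivative[OF assms(2)] by blast
  have pd: "pd UNIV i (\<lambda>y :: real^3. two_velocity f g e (y $ 1)) y = (if i = 1 then two_velocity f' g' e (y $ 1) else 0)" for e y
    by (rule pd_plane_symmetric(2)) (rule two_velocity_derivative[OF f(2) g(2)])
  show ?thesis
  proof (cases "i = 1")
    case True
    with pd f(1) g(1) show ?thesis by (intro exI[of _ f'] exI[of _ g']) auto
  next
    case False
    with pd show ?thesis
      by (intro exI[of _ "\<lambda>_ _. 0"]) (auto simp: two_velocity_def intro: trig_hyp.const)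
  qed
qed

text \<open>The order of quantifiers matters: \<open>f\<close> and \<open>g\<close> depend on
  \<open>ks\<close> but not on \<open>e\<close>, so a sequence of parameters stays within a single
  pair of families.\<close>

lemma iter_pd_velocity_data:
  "\<exists>f g. trig_hyp f \<and> trig_hyp g \<and>
    (\<forall>e. iter_pd ks (velocity_data e) = (\<lambda>y. two_velocity f g e (y $ 1)))"
proof (induction ks)
  case Nil
  have "trig_hyp (\<lambda>e s. cosh (e * sin s))" "trig_hyp (\<lambda>e s. -1 * sinh (e * sin s))"
    by (intro trig_hyp.intros)+
  then show ?case unfolding iter_pd.simps velocity_data_eq by blast
next
  case (Cons k ks)
  then obtain f g where fg: "trig_hyp f" "trig_hyp g"
    "\<And>e. iter_pd ks (velocity_data e) = (\<lambda>y. two_velocity f g e (y $ 1))" by blast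
  from pd_two_velocity[OF fg(1,2), of k] show ?case by (simp add: fg(3))
qed

lemma smooth_velocity_data: "smooth (velocity_data e)"
  unfolding smooth_def
proof
  fix ks :: "3 list"
  obtain f g where fg: "trig_hyp f" "trig_hyp g"
    "iter_pd ks (velocity_data e) = (\<lambda>y. two_velocity f g e (y $ 1))"
    using iter_pd_velocity_data by blast
  obtain f' g' where f: "\<And>e s. (f e has_real_derivative f' e s) (at s)"
    and g: "\<And>e s. (g e has_real_derivative g' e s) (at s)"
    using trig_hyp_derivative[OF fg(1)] trig_hyp_derivative[OF fg(2)] by blast
  have "((\<lambda>y :: real^3. two_velocity f g e (y $ 1)) has_derivative (\<lambda>h. h $ 1 *\<^sub>R two_velocity f' g' e (y $ 1))) (at y)" for y
    by (rule pd_plane_symmetric(1)) (rule two_velocity_derivative[OF f g])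
  then show "iter_pd ks (velocity_data e) differentiable_on UNIV"
    unfolding fg(3) differentiable_on_def differentiable_def by blast
qed

lemma converges_smoothly_velocity_data:
  assumes "\<epsilon> \<longlonglongrightarrow> 0"
  shows "converges_smoothly (\<lambda>n. velocity_data (\<epsilon> n)) (\<lambda>_. axis 0 1)"
  unfolding converges_smoothly_def
proof
  fix ks :: "3 list"
  obtain f g where fg: "trig_hyp f" "trig_hyp g"
    "\<And>e. iter_pd ks (velocity_data e) = (\<lambda>y. two_velocity f g e (y $ 1))"
    using iter_pd_velocity_data by blast
  have "uniform_limit UNIV (\<lambda>n s. two_velocity f g (\<epsilon> n) s) (two_velocity f g 0) sequentially"
    unfolding two_velocity_def
    by (intro uniform_limit_intros bounded_linear.uniform_limit[OF bounded_linear_scaleR_left]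
        trig_hyp_uniform_limit fg assms)
  then have "uniform_limit UNIV (\<lambda>n y. two_velocity f g (\<epsilon> n) (y $ 1)) (\<lambda>y :: real^3. two_velocity f g 0 (y $ 1)) sequentially"
    by (rule uniform_limit_compose') auto
  moreover have "velocity_data 0 = (\<lambda>_. axis 0 1)"
    by (simp add: velocity_data_def fun_eq_iff)
  ultimately show "uniform_limit UNIV (\<lambda>n. iter_pd ks (velocity_data (\<epsilon> n))) (iter_pd ks (\<lambda>_. axis 0 1)) sequentially"
    using fg(3)[of 0] by (simp add: fg(3))
qed

section \<open>The quiet background and admissibility of the data\<close>

text \<open>Dust at rest is diluted by the spatial volume t^(3 alpha): each spatial direction adds
  alpha / t to the divergence of the time axis.\<close>

lemma quiet_dust_solution:
  fixes \<alpha> \<rho>\<^sub>c :: real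
  assumes "0 < \<rho>\<^sub>c"
  defines "\<rho> \<equiv> \<lambda>x :: real^4. \<rho>\<^sub>c * (x $ 0) powr (- (3 * \<alpha>))"
  shows "quiet_fluid_solution (power_law_metric \<alpha>) 0 \<rho> (\<lambda>_. axis 0 1)"
proof -
  define u :: "real^4 \<Rightarrow> real^4" where "u = (\<lambda>_. axis 0 1)"
  have pos: "x $ 0 > 0" if "x \<in> spacetime" for x :: "real^4"
    using that by (simp add: spacetime_def)
  have deriv: "((\<lambda>t. \<rho>\<^sub>c * t powr (- (3 * \<alpha>))) has_real_derivative
      \<rho>\<^sub>c * (- (3 * \<alpha>) * t powr (- (3 * \<alpha>) - 1))) (at t)" if "t > 0" for t
    by (intro DERIV_cmult has_real_derivative_powr that)
  have pd_\<rho>: "pd spacetime i \<rho> x = (if i = 0 then \<rho>\<^sub>c * (- (3 * \<alpha>) * (x $ 0) powr (- (3 * \<alpha>) - 1)) else 0)"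
    if "x \<in> spacetime" for i x
    unfolding \<rho>_def by (rule pd_time_function[OF that deriv[OF pos[OF that]]])
  have cont: "continuous_on spacetime (\<lambda>x :: real^4. c * (x $ 0) powr b)" for b c
    using pos by (intro continuous_intros) (auto simp: less_imp_neq[symmetric])
  have "C1_on spacetime \<rho>"
    unfolding C1_on_def
  proof (intro conjI allI)
    have "\<rho> differentiable (at x within spacetime)" if "x \<in> spacetime" for x
    proof -
      have "(\<lambda>t. \<rho>\<^sub>c * t powr (- (3 * \<alpha>))) differentiable (at (x $ 0))"
        using deriv[OF pos[OF that]] by (rule differentiableI[OF has_field_derivative_imp_has_derivative])
      moreover have "(\<lambda>x :: real^4. x $ 0) differentiable (at x within spacetime)"
        by (intro differentiable_component) simp
      ultimately show ?thesis
        unfolding \<rho>_def by (rule differentiable_compose)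
    qed
    then show "\<rho> differentiable_on spacetime" by (simp add: differentiable_on_def)
    show "continuous_on spacetime (pd spacetime i \<rho>)" for i
    proof (cases "i = 0")
      case True
      have "continuous_on spacetime (\<lambda>x. (\<rho>\<^sub>c * - (3 * \<alpha>)) * (x $ 0) powr (- (3 * \<alpha>) - 1))"
        by (rule cont)
      then show ?thesis
        by (rule continuous_on_eq) (simp add: pd_\<rho> True)
    next
      case False
      show ?thesis
        by (rule continuous_on_eq[OF continuous_on_const[of _ 0]]) (simp add: pd_\<rho> False)
    qed
  qed
  moreover have "C1_on spacetime u"
    unfolding C1_on_def
  proof (intro conjI allI)
    show "u differentiable_on spacetime" by (simp add: u_def)
    show "continuous_on spacetime (pd spacetime i u)" for i
      unfolding u_def
      by (rule continuous_on_eq[OF continuous_on_const[of _ 0]]) (simp add: pd_spacetime_const)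
  qed
  moreover have "space_periodic \<rho>" "space_periodic u"
    by (auto simp: space_periodic_def \<rho>_def u_def axis_eq_if)
  moreover have "future_unit (power_law_metric \<alpha>) x (u x)" if "x \<in> spacetime" for x
    by (simp add: future_unit_def sum_4_zero power_law_metric_def u_def axis_eq_if)
  moreover have "euler_equations (power_law_metric \<alpha>) (\<lambda>y. 0 * \<rho> y) \<rho> u x" if x: "x \<in> spacetime" for x
  proof -
    let ?g = "power_law_metric \<alpha>"
    have cov: "cov_deriv ?g u \<mu> \<nu> x = christoffel ?g \<nu> \<mu> 0 x" for \<mu> \<nu>
      by (simp add: cov_deriv_def u_def pd_spacetime_const[OF x] sum_4_zero axis_eq_if)
    have "\<rho>\<^sub>c * (- (3 * \<alpha>) * (x $ 0) powr (- (3 * \<alpha>) - 1)) + \<rho> x * (3 * \<alpha> / x $ 0) = 0"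
      using pos[OF x] by (simp add: \<rho>_def powr_diff)
    then show ?thesis
      unfolding euler_equations_def cov using x
      by (simp add: pd_\<rho> pd_spacetime_const christoffel_power_law
          sum_4_zero u_def axis_eq_if algebra_simps)
  qed
  moreover have "\<rho> x > 0" if "x \<in> spacetime" for x
    using pos[OF that] assms(1) by (simp add: \<rho>_def)
  ultimately have "fluid_solution (power_law_metric \<alpha>) 0 \<rho> u"
    by (simp add: fluid_solution_def)
  then show ?thesis
    by (simp add: quiet_fluid_solution_def \<rho>_def u_def)
qed

lemma velocity_data_admissible:
  assumes "0 < \<rho>\<^sub>c"
  shows "smooth_initial_data (power_law_metric \<alpha>) (\<lambda>_. \<rho>\<^sub>c) (velocity_data e)"
    and "T2_symmetric_data (\<lambda>_. \<rho>\<^sub>c) (velocity_data e)"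
proof -
  have "iter_pd ks (\<lambda>_ :: real^3. \<rho>\<^sub>c) = (\<lambda>_. if ks = [] then \<rho>\<^sub>c else 0)" for ks
  proof (induction ks)
    case (Cons k ks)
    have "pd UNIV k (\<lambda>_ :: real^3. c) = (\<lambda>_. 0)" for c :: real
      by (simp add: fun_eq_iff pd_def)
    with Cons show ?case by simp
  qed simp
  then have "smooth (\<lambda>_ :: real^3. \<rho>\<^sub>c)" by (simp add: smooth_def)
  moreover have "torus_periodic (velocity_data e)"
    by (auto simp: torus_periodic_def velocity_data_def axis_eq_if)
  moreover have "future_unit (power_law_metric \<alpha>) (event 1 y) (velocity_data e y)" for y
    using hyperbolic_pythagoras[of "e * sin (y $ 1)"]
    by (simp add: future_unit_def sum_4_zero power_law_metric_def velocity_data_def axis_eq_if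
        event_def power2_eq_square)
  ultimately show "smooth_initial_data (power_law_metric \<alpha>) (\<lambda>_. \<rho>\<^sub>c) (velocity_data e)"
    using assms by (simp add: smooth_initial_data_def smooth_velocity_data torus_periodic_def)
  show "T2_symmetric_data (\<lambda>_. \<rho>\<^sub>c) (velocity_data e)"
    by (simp add: T2_symmetric_data_def velocity_data_def axis_eq_if)
qed

section \<open>Collision of two fluid elements in finite time\<close>

text \<open>The speed at time s is at least c / s, so x + c ln s is nonincreasing. The logarithm is
  unbounded, and the intermediate value theorem gives the zero.\<close>

lemma leftward_characteristic_reaches_origin:
  fixes \<alpha> q x\<^sub>0 :: real
  assumes "\<alpha> \<le> 1/2" "0 \<le> \<alpha>" "0 < q" "0 < x\<^sub>0"
  shows "\<exists>x T. \<exists>t\<in>{1..T}. x t = 0 \<and> x 1 = x\<^sub>0 \<and>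
    (\<forall>s\<in>{1..T}. (x has_real_derivative
        s powr (- (2 * \<alpha>)) * (- q) / sqrt (1 + s powr (- (2 * \<alpha>)) * (- q)\<^sup>2)) (at s within {1..T}))"
proof -
  define v where "v s = s powr (- (2 * \<alpha>)) * (- q) / sqrt (1 + s powr (- (2 * \<alpha>)) * (- q)\<^sup>2)" for s
  \<comment> \<open>The speed of the element at time 1.\<close>
  define c where "c = q / sqrt (1 + q\<^sup>2)"
  have "0 < 1 + q\<^sup>2" by (simp add: add_pos_nonneg)
  then have c: "c > 0" using assms(3) by (simp add: c_def)
  \<comment> \<open>The time at which the guaranteed displacement \<open>c * ln T\<close> equals
    \<open>x\<^sub>0\<close>.\<close>
  define T where "T = exp (x\<^sub>0 / c)"
  have T: "T \<ge> 1" "ln T = x\<^sub>0 / c" using c assms(4) by (simp_all add: T_def)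
  have rad: "1 + s powr (- (2 * \<alpha>)) * (- q)\<^sup>2 \<noteq> 0" for s
    by (smt (verit) mult_nonneg_nonneg powr_ge_zero zero_le_power2)
  have "continuous_on {1..T} v"
    unfolding v_def using rad by (intro continuous_intros) (auto simp del: power_minus_even power2_minus)
  then obtain G where G: "\<And>s. s \<in> {1..T} \<Longrightarrow> (G has_vector_derivative v s) (at s within {1..T})"
    using antiderivative_continuous by blast
  define x where "x s = G s - G 1 + x\<^sub>0" for s
  have x: "(x has_real_derivative v s) (at s within {1..T})" if "s \<in> {1..T}" for s
    using G[OF that] unfolding x_def has_real_derivative_iff_has_vector_derivative[symmetric]
    by (auto intro!: derivative_eq_intros)
  have cont: "continuous_on {1..T} x" by (rule DERIV_continuous_on[OF x])
  have v_le: "v s \<le> - c / s" if "s \<ge> 1" for s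
  proof -
    define a where "a = s powr (- (2 * \<alpha>))"
    \<comment> \<open>Here alpha <= 1/2 enters; for larger alpha the power would be integrable at
      infinity.\<close>
    have "s powr (-1) \<le> a" unfolding a_def using assms(1) that by (intro powr_mono) auto
    then have a1: "1 / s \<le> a" using that by (simp add: powr_minus_divide)
    have a2: "a \<le> 1"
      using that assms(2) powr_mono[of "- (2 * \<alpha>)" 0 s] by (simp add: a_def)
    have a0: "0 < a" using that by (simp add: a_def)
    have "(1 / s * q) / sqrt (1 + q\<^sup>2) \<le> (a * q) / sqrt (1 + a * q\<^sup>2)"
    proof (rule frac_le)
      show "0 \<le> a * q" using a0 assms(3) by simp
      show "1 / s * q \<le> a * q" using a1 assms(3) by (intro mult_right_mono) auto
      show "0 < sqrt (1 + a * q\<^sup>2)" using a0 by (simp add: add_pos_nonneg)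
      show "sqrt (1 + a * q\<^sup>2) \<le> sqrt (1 + q\<^sup>2)" using a0 a2 by (simp add: mult_left_le_one_le)
    qed
    moreover have "v s = - ((a * q) / sqrt (1 + a * q\<^sup>2))"
      by (simp add: v_def a_def)
    moreover have "- c / s = - ((1 / s * q) / sqrt (1 + q\<^sup>2))"
      by (simp add: c_def mult.commute)
    ultimately show ?thesis by simp
  qed
  have "x T + c * ln T \<le> x 1 + c * ln 1"
  proof (rule DERIV_nonpos_imp_decreasing_open[of 1 T "\<lambda>s. x s + c * ln s"])
    show "1 \<le> T" by (rule T)
    show "\<exists>y. ((\<lambda>s. x s + c * ln s) has_real_derivative y) (at s) \<and> y \<le> 0" if s: "1 < s" "s < T" for s
    proof (intro exI conjI)
      have "(x has_real_derivative v s) (at s)"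
        using x[of s] s by (simp add: at_within_Icc_at)
      then show "((\<lambda>s. x s + c * ln s) has_real_derivative v s + c * (1 / s)) (at s)"
        using s by (auto intro!: derivative_eq_intros)
      show "v s + c * (1 / s) \<le> 0" using v_le[of s] s by simp
    qed
    show "continuous_on {1..T} (\<lambda>s. x s + c * ln s)"
      by (intro continuous_intros cont) auto
  qed
  then have "x T \<le> 0" using T c by (simp add: x_def)
  moreover have x1: "x 1 = x\<^sub>0" by (simp add: x_def)
  ultimately obtain t where "1 \<le> t" "t \<le> T" "x t = 0"
    using IVT2'[of x T 0 1] cont T assms(4) by auto
  then show ?thesis
    using x x1 unfolding v_def by (intro exI[of _ x] exI[of _ T] bexI[of _ t]) auto
qed

lemma velocity_data_forms_singularity:
  assumes "0 < \<alpha>" "\<alpha> \<le> 1/2" "0 < e"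
  shows "forms_singularity (power_law_metric \<alpha>) 0 \<rho>\<^sub>0 (velocity_data e)"
  unfolding forms_singularity_def
proof safe
  fix \<rho> u
  assume sol: "fluid_solution (power_law_metric \<alpha>) 0 \<rho> u"
    and data: "has_initial_data \<rho> u \<rho>\<^sub>0 (velocity_data e)"
  \<comment> \<open>The initial value of |u^1| at x^1 = pi/2, where the sine is 1; at t = 1 it is
    also the comoving momentum.\<close>
  define q where "q = sinh e"
  have q: "q > 0" using assms(3) by (simp add: q_def)
  have init: "u (plane_event 1 y) = velocity_data e (y *\<^sub>R axis 1 1)" for y
    using data by (simp add: has_initial_data_def flip: event_axis)
  obtain x T t where t: "t \<in> {1..T}" and xt: "x t = 0" and x1: "x 1 = pi / 2"
    and x: "\<And>s. s \<in> {1..T} \<Longrightarrow> (x has_real_derivative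
        s powr (- (2 * \<alpha>)) * (- q) / sqrt (1 + s powr (- (2 * \<alpha>)) * (- q)\<^sup>2)) (at s within {1..T})"
    using leftward_characteristic_reaches_origin[OF assms(2) less_imp_le[OF assms(1)] q pi_half_gt_zero] by blast
  have "t powr (2 * \<alpha>) * u (plane_event t (x t)) $ 1 = - q"
    by (rule momentum_conserved[OF sol _ x _ _ _ t])
      (use assms(1) in \<open>simp_all add: init x1 velocity_data_def axis_eq_if q_def\<close>)
  \<comment> \<open>For p = 0 the prescribed velocity vanishes, so the constant curve at the origin
    qualifies. Both curves end at the same event.\<close>
  moreover have "t powr (2 * \<alpha>) * u (plane_event t 0) $ 1 = 0"
    by (rule momentum_conserved[OF sol _ _ _ _ _ t, where x = "\<lambda>_. 0"])
      (use assms(1) in \<open>simp_all add: init velocity_data_def axis_eq_if\<close>)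
  ultimately show False using q xt by simp
qed

theorem mainTheorem2:
  fixes \<alpha> \<rho>\<^sub>c :: real
  assumes "0 < \<alpha>" and "\<alpha> \<le> 1/2" and "0 < \<rho>\<^sub>c"
  shows "(\<exists>\<rho> u. quiet_fluid_solution (power_law_metric \<alpha>) 0 \<rho> u \<and>
            has_initial_data \<rho> u (\<lambda>_. \<rho>\<^sub>c) (\<lambda>_. axis 0 1)) \<and>
         (\<exists>(\<rho>\<^sub>n :: nat \<Rightarrow> real^3 \<Rightarrow> real) (u\<^sub>n :: nat \<Rightarrow> real^3 \<Rightarrow> real^4).
            (\<forall>n. smooth_initial_data (power_law_metric \<alpha>) (\<rho>\<^sub>n n) (u\<^sub>n n) \<and>
                 T2_symmetric_data (\<rho>\<^sub>n n) (u\<^sub>n n)) \<and>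
            converges_smoothly \<rho>\<^sub>n (\<lambda>_. \<rho>\<^sub>c) \<and>
            converges_smoothly u\<^sub>n (\<lambda>_. axis 0 1) \<and>
            (\<forall>n. forms_singularity (power_law_metric \<alpha>) 0 (\<rho>\<^sub>n n) (u\<^sub>n n)))"
proof (intro conjI)
  have "has_initial_data (\<lambda>x. \<rho>\<^sub>c * (x $ 0) powr (- (3 * \<alpha>))) (\<lambda>_. axis 0 1) (\<lambda>_. \<rho>\<^sub>c) (\<lambda>_. axis 0 1)"
    by (simp add: has_initial_data_def event_def)
  with quiet_dust_solution[OF assms(3)]
  show "\<exists>\<rho> u. quiet_fluid_solution (power_law_metric \<alpha>) 0 \<rho> u \<and>
            has_initial_data \<rho> u (\<lambda>_. \<rho>\<^sub>c) (\<lambda>_. axis 0 1)"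
    by blast
next
  \<comment> \<open>\<open>Suc\<close> keeps every parameter finite and positive; e = 0 would be the
    quiet state itself.\<close>
  let ?u = "\<lambda>n. velocity_data (inverse (real (Suc n)))"
  have "converges_smoothly (\<lambda>_ :: nat. \<lambda>_ :: real^3. \<rho>\<^sub>c) (\<lambda>_. \<rho>\<^sub>c)"
    by (simp add: converges_smoothly_def uniform_limit_const)
  moreover have "converges_smoothly ?u (\<lambda>_. axis 0 1)"
    by (rule converges_smoothly_velocity_data[OF LIMSEQ_inverse_real_of_nat])
  moreover have "forms_singularity (power_law_metric \<alpha>) 0 (\<lambda>_. \<rho>\<^sub>c) (?u n)" for n
    by (rule velocity_data_forms_singularity[OF assms(1,2)]) simp
  ultimately show "\<exists>(\<rho>\<^sub>n :: nat \<Rightarrow> real^3 \<Rightarrow> real) (u\<^sub>n :: nat \<Rightarrow> real^3 \<Rightarrow> real^4).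
            (\<forall>n. smooth_initial_data (power_law_metric \<alpha>) (\<rho>\<^sub>n n) (u\<^sub>n n) \<and>
                 T2_symmetric_data (\<rho>\<^sub>n n) (u\<^sub>n n)) \<and>
            converges_smoothly \<rho>\<^sub>n (\<lambda>_. \<rho>\<^sub>c) \<and>
            converges_smoothly u\<^sub>n (\<lambda>_. axis 0 1) \<and>
            (\<forall>n. forms_singularity (power_law_metric \<alpha>) 0 (\<rho>\<^sub>n n) (u\<^sub>n n))"
    using velocity_data_admissible[OF assms(3)]
    by (intro exI[of _ "\<lambda>_ _. \<rho>\<^sub>c"] exI[of _ ?u]) blast
qed

end
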